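(* Let $R$ be a ring, $n,m$ positive integers, and $C\leq R^n$ and $D\leq R^m$ left codes. Then $(C,D)\leq R^{n+m}$ is an LCD code if and only if $C$ and $D$ are LCD codes.
   Context: Rings are associative with unity, not necessarily commutative. A left code of length $n$ over $R$ is a left $R$-submodule of $R^n$. $(C,D):=\{(c,d)\mid c\in C,\ d\in D\}\le R^{n+m}$ (concatenation of vectors). For $x,y\in R^n$ put $xy:=\sum_{i=1}^n x_iy_i$. For a left code $C\le R^n$, $C^\perp:=\{s\in R^n\mid cs=0\text{ for all }c\in C\}$, and $C$ is a (left) LCD code if $C\cap C^\perp=0$. *)

theory Defs
  imports "Jordan_Normal_Form.Matrix"
begin

(* The sort {ring, monoid_mult} is that of associative unital rings, not necessarily
   commutative.  Unlike ring_1 it does not demand 0 to differ from 1, so the zero ring is included.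
   R^n is carrier_vec n over 'a, xy is the library's scalar_prod, in which the entries of
   the left argument are multiplied from the left, and smult_vec is left multiplication. *)

(* Closure under negation is not listed: it is scalar multiplication by - 1. *)
definition left_code :: "nat \<Rightarrow> 'a::{ring, monoid_mult} vec set \<Rightarrow> bool" where
  "left_code n C \<longleftrightarrow>
     C \<subseteq> carrier_vec n \<and> 0\<^sub>v n \<in> C \<and>
     (\<forall>x\<in>C. \<forall>y\<in>C. x + y \<in> C) \<and> (\<forall>r. \<forall>x\<in>C. r \<cdot>\<^sub>v x \<in> C)"

definition dual_code :: "nat \<Rightarrow> 'a::{ring, monoid_mult} vec set \<Rightarrow> 'a vec set" where
  "dual_code n C = {s \<in> carrier_vec n. \<forall>c\<in>C. c \<bullet> s = 0}"

definition lcd_code :: "nat \<Rightarrow> 'a::{ring, monoid_mult} vec set \<Rightarrow> bool" where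
  "lcd_code n C \<longleftrightarrow> left_code n C \<and> C \<inter> dual_code n C = {0\<^sub>v n}"

definition concat_code :: "'a vec set \<Rightarrow> 'a vec set \<Rightarrow> 'a vec set" where
  "concat_code C D = {c @\<^sub>v d | c d. c \<in> C \<and> d \<in> D}"

lemma left_code_concat_code:
  fixes C D :: "'a::{ring, monoid_mult} vec set"
  assumes C: "left_code n C" and D: "left_code m D"
  shows "left_code (n + m) (concat_code C D)"
proof -
  have dims: "dim_vec c = n" "dim_vec d = m" if "c \<in> C" "d \<in> D" for c d
    using that C D by (auto simp: left_code_def)
  have "concat_code C D \<subseteq> carrier_vec (n + m)"
    using dims by (auto simp: concat_code_def intro!: carrier_vecI)
  moreover have "0\<^sub>v (n + m) = 0\<^sub>v n @\<^sub>v (0\<^sub>v m :: 'a vec)"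
    by (intro eq_vecI) auto
  then have "0\<^sub>v (n + m) \<in> concat_code C D"
    using C D by (auto simp: concat_code_def left_code_def)
  moreover have "x + y \<in> concat_code C D"
    if xy: "x \<in> concat_code C D" "y \<in> concat_code C D" for x y
  proof -
    from xy obtain c d c' d' where e: "x = c @\<^sub>v d" "y = c' @\<^sub>v d'"
      "c \<in> C" "d \<in> D" "c' \<in> C" "d' \<in> D"
      unfolding concat_code_def by blast
    have "x + y = (c + c') @\<^sub>v (d + d')"
      using e dims[of c d] dims[of c' d'] by (intro eq_vecI) auto
    moreover have "c + c' \<in> C" "d + d' \<in> D"
      using e C D by (auto simp: left_code_def)
    ultimately show ?thesis unfolding concat_code_def by blast
  qed
  moreover have "r \<cdot>\<^sub>v x \<in> concat_code C D" if x: "x \<in> concat_code C D" for r x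
  proof -
    from x obtain c d where e: "x = c @\<^sub>v d" "c \<in> C" "d \<in> D"
      unfolding concat_code_def by blast
    have "r \<cdot>\<^sub>v x = (r \<cdot>\<^sub>v c) @\<^sub>v (r \<cdot>\<^sub>v d)"
      using e dims[of c d] by (intro eq_vecI) auto
    moreover have "r \<cdot>\<^sub>v c \<in> C" "r \<cdot>\<^sub>v d \<in> D"
      using e C D by (auto simp: left_code_def)
    ultimately show ?thesis unfolding concat_code_def by blast
  qed
  ultimately show ?thesis by (auto simp: left_code_def)
qed

end

theory Submission
  imports Defs
begin

text \<open>Orthogonality to \<open>(C, D)\<close> splits into orthogonality to \<open>(C, 0)\<close> and to \<open>(0, D)\<close>,
  so the dual of \<open>(C, D)\<close> is \<open>(C\<^sup>\<bottom>, D\<^sup>\<bottom>)\<close> and the hull of \<open>(C, D)\<close> is the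
  concatenation of the hulls of \<open>C\<close> and \<open>D\<close>.\<close>

lemma dual_code_concat_code:
  fixes C D :: "'a::{ring, monoid_mult} vec set"
  assumes "C \<subseteq> carrier_vec n" and "0\<^sub>v n \<in> C"
    and "D \<subseteq> carrier_vec m" and "0\<^sub>v m \<in> D"
  shows "dual_code (n + m) (concat_code C D) = concat_code (dual_code n C) (dual_code m D)"
proof (intro subset_antisym subsetI)
  fix x assume x: "x \<in> dual_code (n + m) (concat_code C D)"
  \<comment> \<open>Membership in the dual fixes the length of \<open>x\<close> as
    \<open>n + m\<close>, so cutting after the first \<open>n\<close> entries loses nothing.\<close>
  let ?s = "vec_first x n" and ?t = "vec_last x m"
  have x_eq: "?s @\<^sub>v ?t = x"
    using x by (simp add: dual_code_def)
  have orth: "c \<bullet> ?s + d \<bullet> ?t = 0" if "c \<in> C" "d \<in> D" for c d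
  proof -
    have "(c @\<^sub>v d) \<bullet> (?s @\<^sub>v ?t) = 0"
      using x x_eq that by (auto simp: dual_code_def concat_code_def)
    then show ?thesis
      using that assms by (subst (asm) scalar_prod_append[of _ n _ m]) auto
  qed
  \<comment> \<open>Pairing \<open>c\<close> with the zero word of \<open>D\<close> kills the second
    summand of \<open>orth\<close>; the zero word of \<open>C\<close> isolates the other summand in
    the same way.\<close>
  have "c \<bullet> ?s = 0" if "c \<in> C" for c
    using orth[OF that \<open>0\<^sub>v m \<in> D\<close>] by simp
  moreover have "d \<bullet> ?t = 0" if "d \<in> D" for d
    using orth[OF \<open>0\<^sub>v n \<in> C\<close> that] by simp
  ultimately have "?s \<in> dual_code n C" "?t \<in> dual_code m D"
    by (auto simp: dual_code_def)
  then have "?s @\<^sub>v ?t \<in> concat_code (dual_code n C) (dual_code m D)"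
    unfolding concat_code_def by blast
  then show "x \<in> concat_code (dual_code n C) (dual_code m D)"
    using x_eq by simp
next
  fix x assume "x \<in> concat_code (dual_code n C) (dual_code m D)"
  then obtain s t where x: "x = s @\<^sub>v t" and s: "s \<in> dual_code n C" and t: "t \<in> dual_code m D"
    unfolding concat_code_def by blast
  have "(c @\<^sub>v d) \<bullet> (s @\<^sub>v t) = 0" if "c \<in> C" "d \<in> D" for c d
    using s t that assms
    by (subst scalar_prod_append[of _ n _ m]) (auto simp: dual_code_def)
  then show "x \<in> dual_code (n + m) (concat_code C D)"
    using s t by (auto simp: x dual_code_def concat_code_def)
qed

text \<open>All first blocks have the common length \<open>n\<close>, so a concatenated vector
  determines both of its blocks: two decompositions of one vector, over \<open>A\<close>,
  \<open>B\<close> and over \<open>A'\<close>, \<open>B'\<close>, must coincide.\<close>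

lemma concat_code_Int:
  assumes "A \<subseteq> carrier_vec n" and "A' \<subseteq> carrier_vec n"
  shows "concat_code A B \<inter> concat_code A' B' = concat_code (A \<inter> A') (B \<inter> B')"
proof -
  have "a = a' \<and> b = b'"
    if "a @\<^sub>v b = a' @\<^sub>v b'" "a \<in> A" "a' \<in> A'" for a b a' b'
    using that assms append_vec_eq[of a n a' b b'] by blast
  then show ?thesis
    unfolding concat_code_def by blast
qed

text \<open>Reduces triviality of the hull of a concatenation to triviality of the two hulls. The
  zero vectors guarantee that every element of \<open>A\<close> or \<open>B\<close> really occurs as
  a block, since it has a partner in the other set.\<close>

lemma concat_code_eq_zero_iff:
  assumes "A \<subseteq> carrier_vec n" and "0\<^sub>v n \<in> A" and "0\<^sub>v m \<in> B"
  shows "concat_code A B = {0\<^sub>v (n + m)} \<longleftrightarrow> A = {0\<^sub>v n} \<and> B = {0\<^sub>v m}"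
proof -
  have zero: "0\<^sub>v (n + m) = 0\<^sub>v n @\<^sub>v 0\<^sub>v m"
    by (intro eq_vecI) auto
  have eq_zero: "a @\<^sub>v b = 0\<^sub>v (n + m) \<longleftrightarrow> a = 0\<^sub>v n \<and> b = 0\<^sub>v m" if "a \<in> A" for a b
    unfolding zero using that assms(1) by (intro append_vec_eq) auto
  show ?thesis
  proof
    assume L: "concat_code A B = {0\<^sub>v (n + m)}"
    have "a = 0\<^sub>v n \<and> b = 0\<^sub>v m" if "a \<in> A" "b \<in> B" for a b
    proof -
      have "a @\<^sub>v b \<in> concat_code A B"
        using that unfolding concat_code_def by blast
      then show ?thesis
        using L eq_zero[OF that(1)] by simp
    qed
    \<comment> \<open>Each \<open>a\<close> is tested together with the zero vector of
      \<open>B\<close>, and each \<open>b\<close> together with that of \<open>A\<close>.\<close>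
    with assms(2,3) show "A = {0\<^sub>v n} \<and> B = {0\<^sub>v m}"
      by blast
  next
    assume "A = {0\<^sub>v n} \<and> B = {0\<^sub>v m}"
    then show "concat_code A B = {0\<^sub>v (n + m)}"
      by (simp add: concat_code_def zero)
  qed
qed

lemma zero_in_dual_code:
  assumes "C \<subseteq> carrier_vec n"
  shows "0\<^sub>v n \<in> dual_code n C"
  using assms by (auto simp: dual_code_def)

theorem proposition3:
  fixes C D :: "'a::{ring, monoid_mult} vec set" and n m :: nat
  assumes "n > 0" and "m > 0"
    and "left_code n C" and "left_code m D"
  shows "lcd_code (n + m) (concat_code C D) \<longleftrightarrow> lcd_code n C \<and> lcd_code m D"
proof -
  have C: "C \<subseteq> carrier_vec n" "0\<^sub>v n \<in> C" and D: "D \<subseteq> carrier_vec m" "0\<^sub>v m \<in> D"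
    using assms(3,4) by (simp_all add: left_code_def)
  have "concat_code C D \<inter> dual_code (n + m) (concat_code C D)
      = concat_code (C \<inter> dual_code n C) (D \<inter> dual_code m D)"
    unfolding dual_code_concat_code[OF C D]
    using C(1) by (intro concat_code_Int) (auto simp: dual_code_def)
  moreover have "concat_code (C \<inter> dual_code n C) (D \<inter> dual_code m D) = {0\<^sub>v (n + m)}
      \<longleftrightarrow> C \<inter> dual_code n C = {0\<^sub>v n} \<and> D \<inter> dual_code m D = {0\<^sub>v m}"
    using C D by (intro concat_code_eq_zero_iff) (auto simp: zero_in_dual_code)
  \<comment> \<open>All three sets are left codes, so each \<open>lcd_code\<close> statement comes
    down to its hull being zero.\<close>
  ultimately show ?thesis
    using assms(3,4) left_code_concat_code[OF assms(3,4)] by (simp add: lcd_code_def)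
qed

end
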